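(* Let $E$ be a linearly ordered topological semilattice. Then $E$ is $H$-closed as a topological semilattice if and only if $E$, equipped with its natural partial order, is $H$-closed as a topological pospace.
   Context: All topological spaces are Hausdorff. A semilattice is a semigroup with a commutative idempotent operation; a topological semilattice is a topological space with a continuous (jointly, as a map $E\times E\to E$) semilattice operation. The natural partial order on a semilattice is defined by $e\leqslant f$ if and only if $ef=fe=e$; a semilattice is linearly ordered if its natural order is linear. A topological semilattice $S$ is $H$-closed if it is a closed subset in every (Hausdorff) topological semilattice which contains $S$ as a subsemilattice (with the subspace topology). A topological pospace is a topological space $X$ equipped with a continuous (closed) partial order $\leqslant$, i.e. one whose graph is closed in $X\times X$; every topological semilattice with its natural order is a topological pospace. A topological pospace $X$ is $H$-closed if $X$ is a closed subspace of every Hausdorff topological pospace in which it is contained (as a subspace with the induced order). *)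

theory Defs
  imports "HOL-Analysis.Analysis"
begin

section \<open>Topological semilattices\<close>

definition semilattice_on :: "'a set \<Rightarrow> ('a \<Rightarrow> 'a \<Rightarrow> 'a) \<Rightarrow> bool" where
  "semilattice_on A m \<longleftrightarrow>
     (\<forall>x\<in>A. \<forall>y\<in>A. m x y \<in> A) \<and>
     (\<forall>x\<in>A. \<forall>y\<in>A. \<forall>z\<in>A. m (m x y) z = m x (m y z)) \<and>
     (\<forall>x\<in>A. \<forall>y\<in>A. m x y = m y x) \<and>
     (\<forall>x\<in>A. m x x = x)"

definition topological_semilattice :: "'a topology \<Rightarrow> ('a \<Rightarrow> 'a \<Rightarrow> 'a) \<Rightarrow> bool" where
  "topological_semilattice X m \<longleftrightarrow>
     Hausdorff_space X \<and> semilattice_on (topspace X) m \<and>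
     continuous_map (prod_topology X X) X (\<lambda>(x, y). m x y)"

definition natural_order :: "'a set \<Rightarrow> ('a \<Rightarrow> 'a \<Rightarrow> 'a) \<Rightarrow> 'a rel" where
  "natural_order A m = {(e, f). e \<in> A \<and> f \<in> A \<and> m e f = e \<and> m f e = e}"

text \<open>``\<open>X\<close> is contained in \<open>Y\<close> as a subsemilattice, with the subspace topology'' is expressed by
  an injection of \<open>X\<close> into \<open>Y\<close> that is a homomorphism and a homeomorphism onto its image.\<close>

definition semilattice_embedding ::
    "'a topology \<Rightarrow> ('a \<Rightarrow> 'a \<Rightarrow> 'a) \<Rightarrow> 'b topology \<Rightarrow> ('b \<Rightarrow> 'b \<Rightarrow> 'b) \<Rightarrow> ('a \<Rightarrow> 'b) \<Rightarrow> bool" where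
  "semilattice_embedding X m Y n f \<longleftrightarrow>
     embedding_map X Y f \<and>
     (\<forall>x\<in>topspace X. \<forall>y\<in>topspace X. f (m x y) = n (f x) (f y))"


section \<open>Topological pospaces\<close>

definition topological_pospace :: "'a topology \<Rightarrow> 'a rel \<Rightarrow> bool" where
  "topological_pospace X r \<longleftrightarrow>
     Hausdorff_space X \<and> partial_order_on (topspace X) r \<and> closedin (prod_topology X X) r"

definition pospace_embedding ::
    "'a topology \<Rightarrow> 'a rel \<Rightarrow> 'b topology \<Rightarrow> 'b rel \<Rightarrow> ('a \<Rightarrow> 'b) \<Rightarrow> bool" where
  "pospace_embedding X r Y s f \<longleftrightarrow>
     embedding_map X Y f \<and>
     (\<forall>x\<in>topspace X. \<forall>y\<in>topspace X. (x, y) \<in> r \<longleftrightarrow> (f x, f y) \<in> s)"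


section \<open>H-closedness\<close>

text \<open>A formula of HOL cannot quantify over the types that carry the extensions of \<open>X\<close>, so the
  extensions in the definitions have their points in one type that is large enough. If \<open>X\<close> is not
  closed in an extension \<open>Y\<close>, and \<open>p\<close> is a point of the closure of \<open>X\<close> outside \<open>X\<close>, then \<open>X\<close> is not
  closed in the subsemilattice \<open>X \<union> pX \<union> {p}\<close> of \<open>Y\<close> (respectively in the subspace \<open>X \<union> {p}\<close>),
  which has a copy in \<open>'a + 'a option\<close>. The theorems
  \<open>H_closed_topological_semilatticeD\<close> and \<open>H_closed_topological_pospaceD\<close> below state that the
  image of \<open>X\<close> is then closed in the extensions over an arbitrary type.\<close>

type_synonym 'a extension = "'a + 'a option"

definition H_closed_topological_semilattice ::
    "'a topology \<Rightarrow> ('a \<Rightarrow> 'a \<Rightarrow> 'a) \<Rightarrow> bool" where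
  "H_closed_topological_semilattice X m \<longleftrightarrow>
     topological_semilattice X m \<and>
     (\<forall>(Y :: 'a extension topology) n f.
        topological_semilattice Y n \<and> semilattice_embedding X m Y n f
          \<longrightarrow> closedin Y (f ` topspace X))"

definition H_closed_topological_pospace :: "'a topology \<Rightarrow> 'a rel \<Rightarrow> bool" where
  "H_closed_topological_pospace X r \<longleftrightarrow>
     topological_pospace X r \<and>
     (\<forall>(Y :: 'a extension topology) s f.
        topological_pospace Y s \<and> pospace_embedding X r Y s f
          \<longrightarrow> closedin Y (f ` topspace X))"


section \<open>Independence of the type of the extensions\<close>

lemma homeomorphic_maps_pullback:
  assumes inj: "inj_on h C" and sub: "h ` C \<subseteq> topspace Y"
  shows "homeomorphic_maps (pullback_topology C h Y) (subtopology Y (h ` C)) h (inv_into C h)"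
proof -
  have top: "topspace (pullback_topology C h Y) = C"
    using sub by (auto simp: topspace_pullback_topology)
  have "continuous_map (pullback_topology C h Y) Y (id \<circ> h)"
    by (rule continuous_map_pullback) simp
  then have 1: "continuous_map (pullback_topology C h Y) (subtopology Y (h ` C)) h"
    by (simp add: continuous_map_in_subtopology top)
  have "continuous_map (subtopology Y (h ` C)) Y (h \<circ> inv_into C h)"
    by (rule continuous_map_eq[of _ _ id]) (auto simp: f_inv_into_f)
  then have 2: "continuous_map (subtopology Y (h ` C)) (pullback_topology C h Y) (inv_into C h)"
    by (rule continuous_map_pullback') (auto simp: inv_into_into)
  show ?thesis
    unfolding homeomorphic_maps_def using 1 2 inj sub by (auto simp: top f_inv_into_f)
qed

text \<open>The hypothesis is given for \<open>'u\<close>; the extension over \<open>'b\<close> is cut down to a subset \<open>A\<close>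
  and copied into \<open>'u\<close>.\<close>

lemma closedin_from_copy:
  fixes Y :: "'b topology" and h :: "'u \<Rightarrow> 'b"
  assumes inj: "inj_on h C" and A: "h ` C = A" "A \<subseteq> topspace Y"
    and emb: "embedding_map X Y f" and fA: "f ` topspace X \<subseteq> A"
    and p: "p \<in> Y closure_of (f ` topspace X)" "p \<in> A"
    and closed: "closedin (pullback_topology C h Y) ((inv_into C h \<circ> f) ` topspace X)"
  shows "p \<in> f ` topspace X"
proof -
  let ?k = "inv_into C h" and ?Z = "pullback_topology C h Y"
  have hom: "homeomorphic_maps ?Z (subtopology Y A) h ?k"
    using homeomorphic_maps_pullback[OF inj] A by blast
  then have "homeomorphic_map ?Z (subtopology Y A) h"
    by (rule homeomorphic_maps_imp_map)
  then have "closedin (subtopology Y A) (h ` ((?k \<circ> f) ` topspace X))"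
    using closed homeomorphic_imp_closed_map unfolding closed_map_def by blast
  also have "h ` ((?k \<circ> f) ` topspace X) = f ` topspace X"
    using fA A(1) by (force simp: image_image f_inv_into_f)
  finally have "(Y closure_of (f ` topspace X)) \<inter> A \<subseteq> f ` topspace X"
    by (metis closedin_Int_closure_of inf.absorb_iff2 inf.commute order_refl)
  then show ?thesis
    using p by blast
qed

lemma embedding_map_copy:
  assumes inj: "inj_on h C" and A: "h ` C = A" "A \<subseteq> topspace Y"
    and emb: "embedding_map X Y f" and fA: "f ` topspace X \<subseteq> A"
  shows "embedding_map X (pullback_topology C h Y) (inv_into C h \<circ> f)"
proof (rule embedding_map_compose)
  show "embedding_map X (subtopology Y A) f"
    using emb fA by (simp add: embedding_map_in_subtopology)
  have "homeomorphic_maps (pullback_topology C h Y) (subtopology Y A) h (inv_into C h)"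
    using homeomorphic_maps_pullback[OF inj] A by blast
  then show "embedding_map (subtopology Y A) (pullback_topology C h Y) (inv_into C h)"
    using surjective_embedding_map homeomorphic_maps_imp_map homeomorphic_maps_sym by metis
qed

lemma continuous_map_copy:
  assumes "h ` C \<subseteq> topspace Y"
  shows "continuous_map (pullback_topology C h Y) Y h"
proof -
  have "continuous_map (pullback_topology C h Y) Y (id \<circ> h)"
    by (rule continuous_map_pullback) simp
  then show ?thesis by simp
qed

lemma Hausdorff_space_copy:
  assumes "inj_on h C" "h ` C \<subseteq> topspace Y" "Hausdorff_space Y"
  shows "Hausdorff_space (pullback_topology C h Y)"
  using assms by (intro Hausdorff_space_injective_preimage[OF _ continuous_map_copy])
    (auto simp: topspace_pullback_topology inj_on_def)

lemma topological_semilattice_copy: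
  assumes inj: "inj_on h C" and sub: "h ` C \<subseteq> topspace Y"
    and Y: "topological_semilattice Y n"
    and cl: "\<And>x y. x \<in> h ` C \<Longrightarrow> y \<in> h ` C \<Longrightarrow> n x y \<in> h ` C"
  shows "topological_semilattice (pullback_topology C h Y)
           (\<lambda>x y. inv_into C h (n (h x) (h y)))"
proof -
  let ?Z = "pullback_topology C h Y" and ?n = "\<lambda>x y. inv_into C h (n (h x) (h y))"
  have top: "topspace ?Z = C"
    using sub by (auto simp: topspace_pullback_topology)
  have hn: "h (?n x y) = n (h x) (h y)" "?n x y \<in> C" if "x \<in> C" "y \<in> C" for x y
    using cl that by (auto simp: f_inv_into_f inv_into_into)
  have S: "semilattice_on (topspace Y) n"
    using Y by (simp add: topological_semilattice_def)
  have hC: "h x \<in> topspace Y" if "x \<in> C" for x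
    using that sub by blast
  have "semilattice_on C ?n"
    unfolding semilattice_on_def
  proof (intro conjI ballI)
    fix x y z assume x: "x \<in> C" and y: "y \<in> C" and z: "z \<in> C"
    have "n (n (h x) (h y)) (h z) = n (h x) (n (h y) (h z))"
      using S hC[OF x] hC[OF y] hC[OF z] unfolding semilattice_on_def by blast
    then show "?n (?n x y) z = ?n x (?n y z)"
      using hn x y z by simp
  next
    fix x y assume "x \<in> C" "y \<in> C"
    then show "?n x y = ?n y x"
      using S hC by (simp add: semilattice_on_def)
  next
    fix x assume "x \<in> C"
    then show "?n x x = x"
      using S hC inj by (simp add: semilattice_on_def)
  qed (use hn in auto)
  moreover have "continuous_map (prod_topology ?Z ?Z) ?Z (\<lambda>(x, y). ?n x y)"
  proof (rule continuous_map_pullback')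
    have h: "continuous_map ?Z Y h"
      using sub by (rule continuous_map_copy)
    have "continuous_map (prod_topology ?Z ?Z) (prod_topology Y Y) (\<lambda>z. (h (fst z), h (snd z)))"
      using h by (auto simp: continuous_map_pairwise o_def
          intro: continuous_map_compose[OF continuous_map_fst, unfolded o_def]
                 continuous_map_compose[OF continuous_map_snd, unfolded o_def])
    moreover have "continuous_map (prod_topology Y Y) Y (\<lambda>(x, y). n x y)"
      using Y by (simp add: topological_semilattice_def)
    ultimately have "continuous_map (prod_topology ?Z ?Z) Y
        ((\<lambda>(x, y). n x y) \<circ> (\<lambda>z. (h (fst z), h (snd z))))"
      by (rule continuous_map_compose)
    then show "continuous_map (prod_topology ?Z ?Z) Y (h \<circ> (\<lambda>(x, y). ?n x y))"
      by (rule continuous_map_eq) (auto simp: top hn)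
    show "topspace (prod_topology ?Z ?Z) \<subseteq> (\<lambda>(x, y). ?n x y) -` C"
      using hn by (auto simp: top)
  qed
  ultimately show ?thesis
    using Hausdorff_space_copy[OF inj sub] Y top by (simp add: topological_semilattice_def)
qed

theorem H_closed_topological_semilatticeD:
  fixes X :: "'a topology" and Y :: "'b topology"
  assumes H: "H_closed_topological_semilattice X m"
    and Y: "topological_semilattice Y n" and f: "semilattice_embedding X m Y n f"
  shows "closedin Y (f ` topspace X)"
proof -
  have emb: "embedding_map X Y f"
    and hom: "\<And>x y. x \<in> topspace X \<Longrightarrow> y \<in> topspace X \<Longrightarrow> f (m x y) = n (f x) (f y)"
    using f by (auto simp: semilattice_embedding_def)
  have fY: "f ` topspace X \<subseteq> topspace Y"
    using emb by (metis embedding_map_def homeomorphic_imp_surjective_map inf_le1 topspace_subtopology)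
  have SY: "semilattice_on (topspace Y) n"
    using Y by (simp add: topological_semilattice_def)
  have SX: "\<And>x y. x \<in> topspace X \<Longrightarrow> y \<in> topspace X \<Longrightarrow> m x y \<in> topspace X"
    using H by (auto simp: H_closed_topological_semilattice_def topological_semilattice_def
        semilattice_on_def)
  have "p \<in> f ` topspace X" if p: "p \<in> Y closure_of (f ` topspace X)" for p
  proof -
    have pY: "p \<in> topspace Y"
      using p by (meson in_closure_of)
    define g :: "'a extension \<Rightarrow> 'b" where
      "g = case_sum f (case_option p (\<lambda>x. n p (f x)))"
    define D where "D = Inl ` topspace X \<union> Inr ` (insert None (Some ` topspace X))"
    define A where "A = g ` D"
    obtain C where C: "C \<subseteq> D" "inj_on g C" "g ` C = A"
      unfolding A_def by (metis subset_image_inj order_refl)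
    have Aeq: "A = f ` topspace X \<union> {p} \<union> (\<lambda>x. n p (f x)) ` topspace X"
      by (auto simp: A_def D_def g_def image_Un image_image)
    have AY: "A \<subseteq> topspace Y"
      using pY fY SY by (auto simp: Aeq semilattice_on_def)
    have mul: "n x y \<in> A" if xy: "x \<in> A" "y \<in> A" for x y
    proof -
      have c: "n x y = n y x" if "x \<in> topspace Y" "y \<in> topspace Y" for x y
        using that SY by (simp add: semilattice_on_def)
      have a: "n (n x y) z = n x (n y z)"
        if "x \<in> topspace Y" "y \<in> topspace Y" "z \<in> topspace Y" for x y z
        using that SY unfolding semilattice_on_def by blast
      have i: "n x x = x" if "x \<in> topspace Y" for x
        using that SY by (simp add: semilattice_on_def)
      have fa: "f a \<in> topspace Y" if "a \<in> topspace X" for a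
        using fY that by blast
      have img: "n (f a) (f b) \<in> f ` topspace X" if "a \<in> topspace X" "b \<in> topspace X" for a b
        using hom[OF that] SX[OF that] by (metis image_eqI)
      have f_mul: "n (f a) z \<in> A" if a_in: "a \<in> topspace X" and z: "z \<in> A" for a z
      proof -
        have "n (f a) (n p (f b)) \<in> A" if "b \<in> topspace X" for b
        proof -
          have "n (f a) (n p (f b)) = n (n (f a) p) (f b)"
            using a fa pY a_in that by simp
          also have "\<dots> = n (n p (f a)) (f b)"
            using c[OF fa[OF a_in] pY] by simp
          also have "\<dots> = n p (n (f a) (f b))"
            using a fa pY a_in that by simp
          finally show ?thesis
            using img[OF a_in that] by (auto simp: Aeq)
        qed
        moreover have "n (f a) p \<in> A"
          using c[OF fa[OF a_in] pY] a_in by (simp add: Aeq)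
        moreover have "n (f a) (f b) \<in> A" if "b \<in> topspace X" for b
          using img[OF a_in that] by (simp add: Aeq)
        ultimately show ?thesis
          using z unfolding Aeq by blast
      qed
      have p_mul: "n p z \<in> A" if z: "z \<in> A" for z
      proof -
        have "n p (n p (f b)) = n p (f b)" if "b \<in> topspace X" for b
          using a[OF pY pY fa[OF that]] i[OF pY] by simp
        then show ?thesis
          using z i[OF pY] by (auto simp: Aeq)
      qed
      have "n (n p (f a)) y \<in> A" if "a \<in> topspace X" for a
        using a[OF pY fa[OF that], of y] xy(2) AY p_mul[OF f_mul[OF that xy(2)]] by auto
      then show ?thesis
        using xy f_mul p_mul unfolding Aeq by blast
    qed
    let ?k = "inv_into C g" and ?Z = "pullback_topology C g Y"
    let ?n = "\<lambda>x y. ?k (n (g x) (g y))"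
    have Z: "topological_semilattice ?Z ?n"
      using C(2) C(3) AY Y mul by (intro topological_semilattice_copy) auto
    have fA: "f ` topspace X \<subseteq> A"
      by (auto simp: Aeq)
    have "embedding_map X ?Z (?k \<circ> f)"
      using embedding_map_copy[OF C(2,3) AY emb fA] .
    moreover have "(?k \<circ> f) (m x y) = ?n ((?k \<circ> f) x) ((?k \<circ> f) y)"
      if "x \<in> topspace X" "y \<in> topspace X" for x y
    proof -
      have "g (?k (f z)) = f z" if "z \<in> topspace X" for z
        using that fA C(3) by (intro f_inv_into_f) auto
      then show ?thesis using hom that by simp
    qed
    ultimately have "semilattice_embedding X m ?Z ?n (?k \<circ> f)"
      by (simp add: semilattice_embedding_def)
    with Z H have "closedin ?Z ((?k \<circ> f) ` topspace X)"
      unfolding H_closed_topological_semilattice_def by blast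
    moreover have "p \<in> A" by (simp add: Aeq)
    ultimately show ?thesis
      using closedin_from_copy[OF C(2,3) AY emb fA p] by blast
  qed
  then show ?thesis
    using fY closure_of_subset_eq by blast
qed

theorem H_closed_topological_pospaceD:
  fixes X :: "'a topology" and Y :: "'b topology"
  assumes H: "H_closed_topological_pospace X r"
    and Y: "topological_pospace Y s" and f: "pospace_embedding X r Y s f"
  shows "closedin Y (f ` topspace X)"
proof -
  have emb: "embedding_map X Y f"
    and ord: "\<And>x y. x \<in> topspace X \<Longrightarrow> y \<in> topspace X \<Longrightarrow> (x, y) \<in> r \<longleftrightarrow> (f x, f y) \<in> s"
    using f by (auto simp: pospace_embedding_def)
  have fY: "f ` topspace X \<subseteq> topspace Y"
    using emb by (metis embedding_map_def homeomorphic_imp_surjective_map inf_le1 topspace_subtopology)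
  have "p \<in> f ` topspace X" if p: "p \<in> Y closure_of (f ` topspace X)" for p
  proof -
    have pY: "p \<in> topspace Y"
      using p by (meson in_closure_of)
    define g :: "'a extension \<Rightarrow> 'b" where "g = case_sum f (\<lambda>_. p)"
    define A where "A = insert p (f ` topspace X)"
    have "A = g ` (insert (Inr None) (Inl ` topspace X))"
      by (auto simp: A_def g_def image_image)
    then obtain C where C: "inj_on g C" "g ` C = A"
      by (metis subset_image_inj order_refl)
    have AY: "A \<subseteq> topspace Y"
      using pY fY by (auto simp: A_def)
    let ?k = "inv_into C g" and ?Z = "pullback_topology C g Y"
    let ?s = "{(x, y). x \<in> C \<and> y \<in> C \<and> (g x, g y) \<in> s}"
    have gC: "g x \<in> topspace Y" if "x \<in> C" for x
      using that C AY by blast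
    have top: "topspace ?Z = C"
      using gC by (auto simp: topspace_pullback_topology)
    have "partial_order_on C ?s"
    proof -
      have "partial_order_on (topspace Y) s"
        using Y by (simp add: topological_pospace_def)
      then have "refl_on (topspace Y) s" "trans s" "antisym s"
        by (auto simp: partial_order_on_def preorder_on_def)
      then show ?thesis
        using gC C(1) unfolding partial_order_on_def preorder_on_def refl_on_def
        by (auto simp: trans_def antisym_def inj_on_def)
    qed
    moreover have "closedin (prod_topology ?Z ?Z) ?s"
    proof -
      have h: "continuous_map ?Z Y g"
        using C AY by (intro continuous_map_copy) auto
      have "continuous_map (prod_topology ?Z ?Z) (prod_topology Y Y) (\<lambda>z. (g (fst z), g (snd z)))"
        using h by (auto simp: continuous_map_pairwise o_def
            intro: continuous_map_compose[OF continuous_map_fst, unfolded o_def]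
                   continuous_map_compose[OF continuous_map_snd, unfolded o_def])
      moreover have "closedin (prod_topology Y Y) s"
        using Y by (simp add: topological_pospace_def)
      ultimately have "closedin (prod_topology ?Z ?Z)
          {z \<in> topspace (prod_topology ?Z ?Z). (g (fst z), g (snd z)) \<in> s}"
        by (rule closedin_continuous_map_preimage)
      also have "{z \<in> topspace (prod_topology ?Z ?Z). (g (fst z), g (snd z)) \<in> s} = ?s"
        by (auto simp: top)
      finally show ?thesis .
    qed
    moreover have "Hausdorff_space ?Z"
      using C AY Y by (intro Hausdorff_space_copy) (auto simp: topological_pospace_def)
    ultimately have Z: "topological_pospace ?Z ?s"
      by (simp add: topological_pospace_def top)
    have fA: "f ` topspace X \<subseteq> A"
      by (auto simp: A_def)
    have "embedding_map X ?Z (?k \<circ> f)"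
      using embedding_map_copy[OF C AY emb fA] .
    moreover have "g (?k (f z)) = f z" "?k (f z) \<in> C" if "z \<in> topspace X" for z
      using that fA C(2) by (auto intro!: f_inv_into_f inv_into_into)
    ultimately have "pospace_embedding X r ?Z ?s (?k \<circ> f)"
      using ord by (simp add: pospace_embedding_def)
    with Z H have "closedin ?Z ((?k \<circ> f) ` topspace X)"
      unfolding H_closed_topological_pospace_def by blast
    moreover have "p \<in> A" by (simp add: A_def)
    ultimately show ?thesis
      using closedin_from_copy[OF C AY emb fA p] by blast
  qed
  then show ?thesis
    using fY closure_of_subset_eq by blast
qed

end

theory Submission
  imports Defs
begin

text \<open>
  Both directions rest on a translation between the two kinds of structure. A topological
  semilattice is a topological pospace under its natural order, since the order is the set on which
  two continuous maps into a Hausdorff space agree. So every embedding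
  of semilattices is an embedding of pospaces, and an \<open>H\<close>-closed pospace is closed in every
  topological semilattice that extends it.

  Conversely, a topological pospace whose order is total is a topological semilattice under
  minimum: the order and its converse are two closed sets that cover the square, the minimum is a
  projection on each of them, and the pieces can be pasted. Linearity passes to extensions as far
  as needed: pairs of comparable points form a closed set, so the closure of a chain in a pospace
  is again a chain. Hence, if a linearly ordered semilattice \<open>E\<close> is embedded in a pospace \<open>Y\<close>, then
  the closure of \<open>E\<close> in \<open>Y\<close> is a topological semilattice that contains \<open>E\<close> as a subsemilattice.
  If \<open>E\<close> is \<open>H\<close>-closed as a semilattice, it is closed in its own closure, and so in \<open>Y\<close>.
\<close>

text \<open>The only topological point is that the order is closed: it is the equalizer of multiplication
  and the first projection, and equalizers of continuous maps into a Hausdorff space are closed.\<close>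

lemma topological_semilattice_imp_pospace:
  assumes "topological_semilattice X m"
  shows "topological_pospace X (natural_order (topspace X) m)"
proof -
  let ?P = "prod_topology X X" and ?r = "natural_order (topspace X) m"
  have H: "Hausdorff_space X" and S: "semilattice_on (topspace X) m"
    and c: "continuous_map ?P X (\<lambda>(x, y). m x y)"
    using assms by (auto simp: topological_semilattice_def)
  have comm: "m x y = m y x" if "x \<in> topspace X" "y \<in> topspace X" for x y
    using S that by (simp add: semilattice_on_def)
  have assoc: "m (m x y) z = m x (m y z)"
    if "x \<in> topspace X" "y \<in> topspace X" "z \<in> topspace X" for x y z
    using S that unfolding semilattice_on_def by blast
  have "refl_on (topspace X) ?r"
    using S by (auto simp: refl_on_def natural_order_def semilattice_on_def)
  moreover have "?r \<subseteq> topspace X \<times> topspace X"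
    by (auto simp: natural_order_def)
  moreover have "trans ?r"
  proof (rule transI)
    fix x y z
    assume "(x, y) \<in> ?r" "(y, z) \<in> ?r"
    then have "x \<in> topspace X" "y \<in> topspace X" "z \<in> topspace X" "m x y = x" "m y z = y"
      by (auto simp: natural_order_def)
    with assoc[of x y z] comm[of x z] show "(x, z) \<in> ?r"
      by (simp add: natural_order_def)
  qed
  moreover have "antisym ?r"
    by (auto simp: antisym_def natural_order_def)
  ultimately have "partial_order_on (topspace X) ?r"
    by (simp add: partial_order_on_def preorder_on_def)
  moreover have "closedin ?P ?r"
  proof -
    have "closedin ?P {z \<in> topspace ?P. (\<lambda>(x, y). m x y) z = fst z}"
      using H c continuous_map_fst by (rule closedin_continuous_maps_eq)
    also have "{z \<in> topspace ?P. (\<lambda>(x, y). m x y) z = fst z} = ?r"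
      using comm by (auto simp: natural_order_def)
    finally show ?thesis .
  qed
  ultimately show ?thesis
    using H by (simp add: topological_pospace_def)
qed

lemma semilattice_embedding_imp_pospace_embedding:
  assumes "semilattice_embedding X m Y n f" and S: "semilattice_on (topspace X) m"
  shows "pospace_embedding X (natural_order (topspace X) m) Y (natural_order (topspace Y) n) f"
proof -
  have emb: "embedding_map X Y f"
    and hom: "\<And>x y. x \<in> topspace X \<Longrightarrow> y \<in> topspace X \<Longrightarrow> n (f x) (f y) = f (m x y)"
    using assms by (auto simp: semilattice_embedding_def)
  have inj: "inj_on f (topspace X)" and sub: "f ` topspace X \<subseteq> topspace Y"
    using emb unfolding embedding_map_def
    by (metis homeomorphic_imp_injective_map,
        metis homeomorphic_imp_surjective_map inf_le1 topspace_subtopology)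
  have mX: "m x y \<in> topspace X" if "x \<in> topspace X" "y \<in> topspace X" for x y
    using S that by (simp add: semilattice_on_def)
  have "(x, y) \<in> natural_order (topspace X) m \<longleftrightarrow> (f x, f y) \<in> natural_order (topspace Y) n"
    if "x \<in> topspace X" "y \<in> topspace X" for x y
    using that sub hom mX inj_on_eq_iff[OF inj] by (auto simp: natural_order_def)
  then show ?thesis
    using emb by (simp add: pospace_embedding_def)
qed

lemma total_on_comparable:
  assumes "refl_on A r" "total_on A r" "x \<in> A" "y \<in> A"
  shows "(x, y) \<in> r \<or> (y, x) \<in> r"
  using assms by (cases "x = y") (auto simp: refl_on_def total_on_def)

lemma closedin_converse:
  assumes "closedin (prod_topology X X) r"
  shows "closedin (prod_topology X X) (r\<inverse>)"
proof -
  let ?P = "prod_topology X X"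
  have "continuous_map ?P ?P (\<lambda>z. (snd z, fst z))"
    by (simp add: continuous_map_pairwise o_def continuous_map_fst continuous_map_snd)
  then have "closedin ?P {z \<in> topspace ?P. (snd z, fst z) \<in> r}"
    using assms by (rule closedin_continuous_map_preimage)
  also have "{z \<in> topspace ?P. (snd z, fst z) \<in> r} = r\<inverse>"
    using closedin_subset[OF assms] by auto
  finally show ?thesis .
qed

text \<open>The closure of a square is the square of the closure, so closedness of the comparability
  relation carries over from a chain to its closure.\<close>

lemma pospace_total_on_closure:
  assumes Y: "topological_pospace Y s" and tot: "total_on A s" and A: "A \<subseteq> topspace Y"
  shows "total_on (Y closure_of A) s"
proof -
  have cl: "closedin (prod_topology Y Y) s" and refl: "refl_on (topspace Y) s"
    using Y by (auto simp: topological_pospace_def partial_order_on_def preorder_on_def)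
  have "closedin (prod_topology Y Y) (s \<union> s\<inverse>)"
    using cl closedin_converse by blast
  moreover have "refl_on A s"
    using refl A by (auto simp: refl_on_def)
  then have "A \<times> A \<subseteq> s \<union> s\<inverse>"
    using total_on_comparable[OF _ tot] by auto
  ultimately have "prod_topology Y Y closure_of (A \<times> A) \<subseteq> s \<union> s\<inverse>"
    by (rule closure_of_minimal[rotated])
  then show ?thesis
    by (auto simp: closure_of_Times total_on_def)
qed

lemma topological_pospace_subtopology:
  assumes Y: "topological_pospace Y s" and C: "C \<subseteq> topspace Y"
  shows "topological_pospace (subtopology Y C) (s \<inter> C \<times> C)"
proof -
  have cl: "closedin (prod_topology Y Y) s"
    using Y by (simp add: topological_pospace_def)
  have "refl_on (topspace Y) s" "trans s" "antisym s"
    using Y by (auto simp: topological_pospace_def partial_order_on_def preorder_on_def)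
  then have "partial_order_on C (s \<inter> C \<times> C)"
    using C unfolding partial_order_on_def preorder_on_def refl_on_def
    by (auto simp: antisym_def intro!: transI dest: transD)
  moreover have "closedin (prod_topology (subtopology Y C) (subtopology Y C)) (s \<inter> C \<times> C)"
    using cl by (auto simp: closedin_subtopology simp flip: subtopology_Times)
  ultimately show ?thesis
    using Y C by (simp add: topological_pospace_def Hausdorff_space_subtopology inf.absorb2)
qed

definition order_min :: "'a rel \<Rightarrow> 'a \<Rightarrow> 'a \<Rightarrow> 'a" where
  "order_min r x y = (if (x, y) \<in> r then x else y)"

lemma semilattice_on_order_min:
  assumes "linear_order_on A r"
  shows "semilattice_on A (order_min r)"
proof -
  have tot: "(x, y) \<in> r \<or> (y, x) \<in> r" if "x \<in> A" "y \<in> A" for x y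
    using assms that
    by (intro total_on_comparable)
      (auto simp: linear_order_on_def partial_order_on_def preorder_on_def)
  have t: "(x, z) \<in> r" if "(x, y) \<in> r" "(y, z) \<in> r" for x y z
    using assms that
    by (auto simp: linear_order_on_def partial_order_on_def preorder_on_def dest: transD)
  have a: "x = y" if "(x, y) \<in> r" "(y, x) \<in> r" for x y
    using assms that by (auto simp: linear_order_on_def partial_order_on_def dest: antisymD)
  show ?thesis
    unfolding semilattice_on_def
  proof (intro conjI ballI)
    fix x y z assume "x \<in> A" "y \<in> A" "z \<in> A"
    then show "order_min r (order_min r x y) z = order_min r x (order_min r y z)"
      using t[of x y z] t[of z y x] tot[of x y] tot[of y z] a[of x y] a[of y z] a[of x z]
      by (auto simp: order_min_def)
  next
    fix x y assume "x \<in> A" "y \<in> A"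
    then show "order_min r x y = order_min r y x"
      using tot a by (auto simp: order_min_def)
  qed (auto simp: order_min_def)
qed

text \<open>The minimum is the first projection on \<open>r\<close> and the second on its complement. By totality the
  complement lies in the converse of \<open>r\<close>, which is closed, so a point of the frontier of \<open>r\<close> lies
  in both \<open>r\<close> and its converse. By antisymmetry it is on the diagonal, where the two projections
  agree.\<close>

lemma continuous_map_order_min:
  assumes X: "topological_pospace X r" and tot: "total_on (topspace X) r"
  shows "continuous_map (prod_topology X X) X (\<lambda>(x, y). order_min r x y)"
proof -
  let ?P = "prod_topology X X"
  have cl: "closedin ?P r" and refl: "refl_on (topspace X) r" and anti: "antisym r"
    using X by (auto simp: topological_pospace_def partial_order_on_def preorder_on_def)
  have "{z \<in> topspace ?P. z \<notin> r} \<subseteq> r\<inverse>"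
    using total_on_comparable[OF refl tot] by auto
  then have snd: "?P closure_of {z \<in> topspace ?P. z \<notin> r} \<subseteq> r\<inverse>"
    using closedin_converse[OF cl] by (rule closure_of_minimal)
  have fst: "?P closure_of {z \<in> topspace ?P. z \<in> r} \<subseteq> r"
    using cl by (intro closure_of_minimal) auto
  have "continuous_map ?P X (\<lambda>z. if z \<in> r then fst z else snd z)"
  proof (rule continuous_map_cases_alt)
    fix z assume "z \<in> ?P frontier_of {z \<in> topspace ?P. z \<in> r}"
    moreover have "topspace ?P - {z \<in> topspace ?P. z \<in> r} = {z \<in> topspace ?P. z \<notin> r}"
      by blast
    ultimately have "z \<in> r" "z \<in> r\<inverse>"
      using fst snd unfolding frontier_of_closures by auto
    then show "fst z = snd z"
      using anti by (cases z) (auto dest: antisymD)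
  qed (auto intro: continuous_map_from_subtopology continuous_map_fst continuous_map_snd)
  then show ?thesis
    by (simp add: order_min_def case_prod_unfold)
qed

lemma linear_pospace_imp_topological_semilattice:
  assumes "topological_pospace X r" and "total_on (topspace X) r"
  shows "topological_semilattice X (order_min r)"
  using assms continuous_map_order_min semilattice_on_order_min[of "topspace X" r]
  by (auto simp: topological_semilattice_def topological_pospace_def linear_order_on_def)

lemma order_min_natural_order:
  assumes lin: "linear_order_on A (natural_order A m)" and x: "x \<in> A" and y: "y \<in> A"
  shows "order_min (natural_order A m) x y = m x y"
proof -
  have "(x, y) \<in> natural_order A m \<or> (y, x) \<in> natural_order A m"
    using lin x y
    by (intro total_on_comparable)
      (auto simp: linear_order_on_def partial_order_on_def preorder_on_def)
  then show ?thesis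
    by (auto simp: order_min_def natural_order_def)
qed

theorem proposition3p3:
  fixes E :: "'a topology" and m :: "'a \<Rightarrow> 'a \<Rightarrow> 'a"
  assumes "topological_semilattice E m"
    and "linear_order_on (topspace E) (natural_order (topspace E) m)"
  shows "H_closed_topological_semilattice E m \<longleftrightarrow>
         H_closed_topological_pospace E (natural_order (topspace E) m)"
proof
  let ?r = "natural_order (topspace E) m"
  assume H: "H_closed_topological_semilattice E m"
  have "closedin Y (f ` topspace E)"
    if Y: "topological_pospace Y s" and f: "pospace_embedding E ?r Y s f"
    for Y :: "'a extension topology" and s f
  proof -
    have emb: "embedding_map E Y f"
      and ord: "\<And>x y. x \<in> topspace E \<Longrightarrow> y \<in> topspace E \<Longrightarrow> (x, y) \<in> ?r \<longleftrightarrow> (f x, f y) \<in> s"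
      using f by (auto simp: pospace_embedding_def)
    have fY: "f ` topspace E \<subseteq> topspace Y"
      using emb unfolding embedding_map_def
      by (metis homeomorphic_imp_surjective_map inf_le1 topspace_subtopology)
    define C where "C = Y closure_of (f ` topspace E)"
    define n where "n = order_min (s \<inter> C \<times> C)"
    have CY: "C \<subseteq> topspace Y" and fC: "f ` topspace E \<subseteq> C"
      using fY by (auto simp: C_def closure_of_subset_topspace closure_of_subset subsetD)
    have "total_on (f ` topspace E) s"
      using assms(2) ord by (auto simp: linear_order_on_def total_on_def)
    then have "total_on C (s \<inter> C \<times> C)"
      using pospace_total_on_closure[OF Y _ fY] by (auto simp: C_def total_on_def)
    then have "topological_semilattice (subtopology Y C) n"
      using topological_pospace_subtopology[OF Y CY] CY
      by (auto simp: n_def inf.absorb2 intro: linear_pospace_imp_topological_semilattice)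
    moreover have "semilattice_embedding E m (subtopology Y C) n f"
    proof -
      have "f (m x y) = n (f x) (f y)" if "x \<in> topspace E" "y \<in> topspace E" for x y
      proof -
        have "f x \<in> C" "f y \<in> C"
          using that fC by auto
        then have "f (order_min ?r x y) = n (f x) (f y)"
          using ord[OF that] by (simp add: n_def order_min_def)
        then show ?thesis
          using order_min_natural_order[OF assms(2) that] by simp
      qed
      then show ?thesis
        using emb fC by (simp add: semilattice_embedding_def embedding_map_in_subtopology)
    qed
    ultimately have "closedin (subtopology Y C) (f ` topspace E)"
      using H unfolding H_closed_topological_semilattice_def by blast
    then show ?thesis
      unfolding C_def by (rule closedin_trans_full) simp
  qed
  then show "H_closed_topological_pospace E ?r"
    using topological_semilattice_imp_pospace[OF assms(1)]
    unfolding H_closed_topological_pospace_def by blast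
next
  assume "H_closed_topological_pospace E (natural_order (topspace E) m)"
  then show "H_closed_topological_semilattice E m"
    using assms(1) topological_semilattice_imp_pospace semilattice_embedding_imp_pospace_embedding
    unfolding H_closed_topological_semilattice_def H_closed_topological_pospace_def
      topological_semilattice_def[of E] by blast
qed

end
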